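(* Let $d\ge 1$ be an integer. There is a bijection between the set $\mathcal P_d$ of all set partitions of $[d]=\{1,\dots,d\}$ and the collection $\mathcal F_{\mathcal S_d}=\{\mathrm{Fix}_{\mathcal G}\mid \mathcal G\le \mathcal S_d\}$ of all fixed-point subspaces of $\mathbb R^d$ of subgroups of $\mathcal S_d$.
   Context: $\mathcal S_d$ is the group of all bijections $[d]\to[d]$. It acts on $\mathbb R^d$ by permuting coordinates: $g\cdot x=(x_{g(i)})_{i\in[d]}$. For a subgroup $\mathcal G\le \mathcal S_d$, its fixed-point subspace is $\mathrm{Fix}_{\mathcal G}=\{x\in\mathbb R^d\mid g\cdot x=x\ \ \forall g\in\mathcal G\}$. Different subgroups may share the same fixed-point subspace; $\mathcal F_{\mathcal S_d}$ is the set of distinct subspaces so obtained. *)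

theory Defs
  imports "HOL-Analysis.Finite_Cartesian_Product" "HOL-Algebra.Bij" "HOL-Library.Disjoint_Sets"
begin

text \<open>The index set \<open>[d]\<close> is the universe of an arbitrary finite (hence nonempty) type \<open>'d\<close>,
  with \<open>d = CARD('d) \<ge> 1\<close>. Every \<open>d \<ge> 1\<close> arises in this way.\<close>

definition all_set_partitions :: "'d::finite set set set" where
  "all_set_partitions = {P. partition_on UNIV P}"

definition perm_group :: "('d::finite \<Rightarrow> 'd) monoid" where
  "perm_group = BijGroup UNIV"

text \<open>With composition of functions as the product, this formula defines a right action.\<close>

definition perm_act :: "('d::finite \<Rightarrow> 'd) \<Rightarrow> real ^ 'd \<Rightarrow> real ^ 'd" where
  "perm_act g x = (\<chi> i. x $ g i)"

definition fix_space :: "('d::finite \<Rightarrow> 'd) set \<Rightarrow> (real ^ 'd) set" where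
  "fix_space G = {x. \<forall>g\<in>G. perm_act g x = x}"

definition fixed_point_subspaces :: "(real ^ 'd::finite) set set" where
  "fixed_point_subspaces = {fix_space G | G. subgroup G perm_group}"

end

theory Submission
  imports Defs "HOL-Combinatorics.Transposition"
begin

text \<open>To a partition \<open>P\<close> attach the space \<open>block_space P\<close> of vectors that are constant on every block.
  The coordinates that agree on all of \<open>block_space P\<close> are those in a common block, as the indicator
  vector of a block shows, so \<open>P\<close> can be recovered from it. The subspace is fixed by the group of
  block-preserving permutations; conversely, the fixed space of \<open>G\<close> consists of the vectors that are
  constant on the orbits of \<open>G\<close>.\<close>

definition block_space :: "'d::finite set set \<Rightarrow> (real ^ 'd) set" where
  "block_space P = {x. \<forall>B\<in>P. \<forall>i\<in>B. \<forall>j\<in>B. x $ i = x $ j}"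

text \<open>For a partition \<open>P\<close> this is its Young subgroup: blocks are mapped onto
  themselves, not merely permuted among each other. The equivalence, in place of one implication,
  makes closure under inverses immediate.\<close>

definition block_stabilizer :: "'d::finite set set \<Rightarrow> ('d \<Rightarrow> 'd) set" where
  "block_stabilizer P = {g. bij g \<and> (\<forall>B\<in>P. \<forall>i. g i \<in> B \<longleftrightarrow> i \<in> B)}"

definition orbit_rel :: "('d \<Rightarrow> 'd) set \<Rightarrow> ('d \<times> 'd) set" where
  "orbit_rel G = {(i, g i) | i g. g \<in> G}"

lemma mem_fix_space_iff: "x \<in> fix_space G \<longleftrightarrow> (\<forall>g\<in>G. \<forall>i. x $ i = x $ g i)"
  unfolding fix_space_def perm_act_def vec_eq_iff by (simp add: eq_commute)

lemma Bij_UNIV: "Bij UNIV = {f. bij f}"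
  by (auto simp: Bij_def)

lemma group_perm_group: "group perm_group"
  by (simp add: perm_group_def group_BijGroup)

lemma carrier_perm_group: "carrier perm_group = {f. bij f}"
  by (simp add: perm_group_def BijGroup_def Bij_UNIV)

lemma one_perm_group: "\<one>\<^bsub>perm_group\<^esub> = id"
  by (simp add: perm_group_def BijGroup_def id_def restrict_def)

lemma mult_perm_group:
  assumes "bij f" "bij g"
  shows "f \<otimes>\<^bsub>perm_group\<^esub> g = f \<circ> g"
  using assms by (auto simp: perm_group_def BijGroup_def Bij_UNIV compose_def)

lemma inv_perm_group:
  assumes "bij f"
  shows "inv\<^bsub>perm_group\<^esub> f = inv_into UNIV f"
  using assms inv_BijGroup[of f UNIV] by (simp add: perm_group_def Bij_UNIV restrict_def)

lemma subgroup_block_stabilizer: "subgroup (block_stabilizer P) perm_group"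
proof (rule group.subgroupI[OF group_perm_group])
  show "block_stabilizer P \<subseteq> carrier perm_group"
    by (auto simp: block_stabilizer_def carrier_perm_group)
  have "id \<in> block_stabilizer P"
    by (simp add: block_stabilizer_def)
  then show "block_stabilizer P \<noteq> {}"
    by blast
next
  fix g assume g: "g \<in> block_stabilizer P"
  then have "bij g" and pres: "\<And>B i. B \<in> P \<Longrightarrow> g i \<in> B \<longleftrightarrow> i \<in> B"
    by (auto simp: block_stabilizer_def)
  \<comment> \<open>The preservation property is applied at the preimage of \<open>i\<close>, which
    \<open>g\<close> sends back to \<open>i\<close>.\<close>
  moreover have "inv_into UNIV g i \<in> B \<longleftrightarrow> i \<in> B" if "B \<in> P" for B i
    using pres[OF that, of "inv_into UNIV g i"] \<open>bij g\<close> by (simp add: bij_is_surj surj_f_inv_f)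
  ultimately show "inv\<^bsub>perm_group\<^esub> g \<in> block_stabilizer P"
    by (simp add: block_stabilizer_def inv_perm_group bij_imp_bij_inv)
next
  fix g h assume "g \<in> block_stabilizer P" "h \<in> block_stabilizer P"
  then show "g \<otimes>\<^bsub>perm_group\<^esub> h \<in> block_stabilizer P"
    by (simp add: block_stabilizer_def mult_perm_group bij_comp)
qed

text \<open>By disjointness every block contains both of \<open>i\<close>, \<open>j\<close> or
  neither, so swapping them moves no point across blocks. These transpositions suffice to force
  equal coordinates within a block.\<close>

lemma transpose_in_block_stabilizer:
  assumes "disjoint P" "B \<in> P" "i \<in> B" "j \<in> B"
  shows "transpose i j \<in> block_stabilizer P"
proof -
  have "i \<in> C \<longleftrightarrow> j \<in> C" if "C \<in> P" for C
    using disjointD[OF assms(1,2) that] assms(3,4) by blast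
  then show ?thesis
    by (auto simp: block_stabilizer_def transpose_def)
qed

lemma fix_space_block_stabilizer:
  assumes "partition_on UNIV P"
  shows "fix_space (block_stabilizer P) = block_space P"
proof (intro equalityI subsetI)
  fix x assume x: "x \<in> fix_space (block_stabilizer P)"
  have "x $ i = x $ j" if "B \<in> P" "i \<in> B" "j \<in> B" for B i j
  proof -
    \<comment> \<open>Invariance under the transposition, read at coordinate \<open>j\<close>; the
      index on the right is \<open>i\<close>.\<close>
    have "x $ j = x $ transpose i j j"
      using transpose_in_block_stabilizer[OF partition_onD2[OF assms] that] x
      unfolding mem_fix_space_iff by blast
    then show ?thesis
      by simp
  qed
  then show "x \<in> block_space P"
    unfolding block_space_def by blast
next
  fix x assume x: "x \<in> block_space P"
  have "x $ i = x $ g i" if "g \<in> block_stabilizer P" for g i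
  proof -
    obtain B where "B \<in> P" "i \<in> B"
      using partition_onD1[OF assms] by blast
    with that have "g i \<in> B"
      by (simp add: block_stabilizer_def)
    with x \<open>B \<in> P\<close> \<open>i \<in> B\<close> show ?thesis
      unfolding block_space_def by blast
  qed
  then show "x \<in> fix_space (block_stabilizer P)"
    unfolding mem_fix_space_iff by blast
qed

text \<open>Identity, inverses and products of the group yield reflexivity, symmetry and
  transitivity, in this order.\<close>

lemma equiv_orbit_rel:
  assumes "subgroup G perm_group"
  shows "equiv UNIV (orbit_rel G)"
proof (rule equivI)
  have bij: "bij g" if "g \<in> G" for g
    using subgroup.subset[OF assms] that by (auto simp: carrier_perm_group)
  show "orbit_rel G \<subseteq> UNIV \<times> UNIV"
    by simp
  have "id \<in> G"
    using subgroup.one_closed[OF assms] by (simp add: one_perm_group)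
  then have "(i, id i) \<in> orbit_rel G" for i
    unfolding orbit_rel_def by blast
  then show "refl (orbit_rel G)"
    by (simp add: refl_on_def)
  show "sym (orbit_rel G)"
  proof (rule symI)
    fix i j assume "(i, j) \<in> orbit_rel G"
    then obtain g where "g \<in> G" "j = g i"
      by (auto simp: orbit_rel_def)
    moreover from this have "inv_into UNIV g \<in> G"
      using subgroup.m_inv_closed[OF assms, of g] by (simp add: inv_perm_group bij)
    moreover have "i = inv_into UNIV g j"
      using calculation bij by (simp add: bij_is_inj)
    ultimately show "(j, i) \<in> orbit_rel G"
      by (auto simp: orbit_rel_def)
  qed
  show "trans (orbit_rel G)"
  proof (rule transI)
    fix i j k assume "(i, j) \<in> orbit_rel G" "(j, k) \<in> orbit_rel G"
    then obtain g h where "g \<in> G" "h \<in> G" "k = (h \<circ> g) i"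
      by (auto simp: orbit_rel_def)
    moreover from this have "h \<circ> g \<in> G"
      using subgroup.m_closed[OF assms, of h g] by (simp add: mult_perm_group bij)
    ultimately show "(i, k) \<in> orbit_rel G"
      unfolding orbit_rel_def by blast
  qed
qed

text \<open>Two indices lie in a common class exactly when they are related. This turns a condition
  on blocks into one on pairs, the form in which orbits meet the fixed space.\<close>

lemma block_space_quotient:
  fixes r :: "('d::finite \<times> 'd) set"
  assumes "equiv UNIV r"
  shows "block_space (UNIV // r) = {x. \<forall>(i, j)\<in>r. x $ i = x $ j}"
proof (intro equalityI subsetI)
  fix x :: "real ^ 'd" assume x: "x \<in> block_space (UNIV // r)"
  have "x $ i = x $ j" if "(i, j) \<in> r" for i j
  proof -
    have "r `` {i} \<in> UNIV // r" "i \<in> r `` {i}" "j \<in> r `` {i}"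
      using that equiv_class_self[OF assms] by (auto intro: quotientI)
    with x show ?thesis
      unfolding block_space_def by blast
  qed
  then show "x \<in> {x. \<forall>(i, j)\<in>r. x $ i = x $ j}"
    by blast
next
  fix x :: "real ^ 'd" assume "x \<in> {x. \<forall>(i, j)\<in>r. x $ i = x $ j}"
  then show "x \<in> block_space (UNIV // r)"
    using quotient_eq_iff[OF assms] unfolding block_space_def by blast
qed

text \<open>The pairs in \<open>orbit_rel G\<close> are the \<open>(i, g i)\<close>, so equality of
  coordinates along them is literally invariance under \<open>G\<close>. This gives
  surjectivity.\<close>

lemma fix_space_eq_block_space_orbits:
  assumes "subgroup G perm_group"
  shows "fix_space G = block_space (UNIV // orbit_rel G)"
  unfolding block_space_quotient[OF equiv_orbit_rel[OF assms]]
  unfolding set_eq_iff mem_fix_space_iff orbit_rel_def by blast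

lemma block_eq_agreeing_coordinates:
  assumes "partition_on UNIV P" "B \<in> P" "i \<in> B"
  shows "B = {j. \<forall>x\<in>block_space P. x $ i = x $ j}"
proof (intro equalityI subsetI)
  fix j assume "j \<in> B"
  with assms show "j \<in> {j. \<forall>x\<in>block_space P. x $ i = x $ j}"
    unfolding block_space_def by blast
next
  fix j assume j: "j \<in> {j. \<forall>x\<in>block_space P. x $ i = x $ j}"
  \<comment> \<open>The indicator vector of \<open>B\<close> separates \<open>B\<close> from its
    complement, and it is constant on each block \<open>C\<close> because \<open>C\<close> is either
    \<open>B\<close> or disjoint from \<open>B\<close>.\<close>
  define x :: "real ^ 'a" where "x = (\<chi> k. of_bool (k \<in> B))"
  have "x $ k = x $ l" if "C \<in> P" "k \<in> C" "l \<in> C" for C k l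
  proof -
    have "k \<in> B \<longleftrightarrow> l \<in> B"
      using disjointD[OF partition_onD2[OF assms(1)] assms(2) that(1)] that(2,3) by blast
    then show ?thesis
      by (simp add: x_def)
  qed
  then have "x \<in> block_space P"
    unfolding block_space_def by blast
  with j have "x $ i = x $ j"
    by blast
  with \<open>i \<in> B\<close> show "j \<in> B"
    by (simp add: x_def split: if_splits)
qed

text \<open>Blocks are nonempty, so each one arises from some index; the blocks cover all indices,
  so each index yields a block.\<close>

lemma blocks_from_block_space:
  assumes "partition_on UNIV P"
  shows "P = range (\<lambda>i. {j. \<forall>x\<in>block_space P. x $ i = x $ j})"
proof (intro equalityI subsetI)
  fix B assume "B \<in> P"
  then obtain i where "i \<in> B"
    using partition_onD3[OF assms] by fastforce
  with block_eq_agreeing_coordinates[OF assms \<open>B \<in> P\<close>]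
  show "B \<in> range (\<lambda>i. {j. \<forall>x\<in>block_space P. x $ i = x $ j})"
    by blast
next
  fix B assume "B \<in> range (\<lambda>i. {j. \<forall>x\<in>block_space P. x $ i = x $ j})"
  then obtain i where B: "B = {j. \<forall>x\<in>block_space P. x $ i = x $ j}"
    by blast
  obtain C where "C \<in> P" "i \<in> C"
    using partition_onD1[OF assms] by blast
  with block_eq_agreeing_coordinates[OF assms this] B show "B \<in> P"
    by simp
qed

lemma inj_on_block_space: "inj_on block_space all_set_partitions"
proof (rule inj_onI)
  fix P Q :: "'a set set"
  assume "P \<in> all_set_partitions" "Q \<in> all_set_partitions"
  then have P: "partition_on UNIV P" and Q: "partition_on UNIV Q"
    by (simp_all add: all_set_partitions_def)
  assume "block_space P = block_space Q"
  \<comment> \<open>The recovery formula mentions the partition only through its block space, so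
    \<open>Q\<close> may replace \<open>P\<close> on the right.\<close>
  then have "P = range (\<lambda>i. {j. \<forall>x\<in>block_space Q. x $ i = x $ j})"
    by (rule subst) (rule blocks_from_block_space[OF P])
  also have "\<dots> = Q"
    by (rule blocks_from_block_space[OF Q, symmetric])
  finally show "P = Q" .
qed

theorem proposition1:
  "\<exists>f. bij_betw f (all_set_partitions :: 'd::finite set set set)
         (fixed_point_subspaces :: (real ^ 'd) set set)"
proof (intro exI[of _ block_space] bij_betw_imageI equalityI subsetI)
  show "inj_on block_space (all_set_partitions :: 'd set set set)"
    by (rule inj_on_block_space)
next
  fix V :: "(real ^ 'd) set"
  assume "V \<in> block_space ` all_set_partitions"
  then obtain P where "partition_on UNIV P" "V = block_space P"
    by (auto simp: all_set_partitions_def)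
  then show "V \<in> fixed_point_subspaces"
    using fix_space_block_stabilizer subgroup_block_stabilizer
    unfolding fixed_point_subspaces_def by blast
next
  fix V :: "(real ^ 'd) set"
  assume "V \<in> fixed_point_subspaces"
  then obtain G where "subgroup G perm_group" "V = fix_space G"
    by (auto simp: fixed_point_subspaces_def)
  \<comment> \<open>The preimage of \<open>V\<close> is the partition into orbits of
    \<open>G\<close>.\<close>
  then show "V \<in> block_space ` all_set_partitions"
    by (simp add: fix_space_eq_block_space_orbits all_set_partitions_def
        partition_on_quotient equiv_orbit_rel)
qed

end
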